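(* For every $S>0$ there exists a sequence $(x_n)_{n\in\mathbb N}\subseteq[0,1]$ such that $\lim_{N\to\infty}R_2(s,N)=2s$ for all $0<s<S$, but $(x_n)_{n\in\mathbb N}$ is not uniformly distributed mod $1$, and hence does not have Poissonian pair correlations.
   Context: For $x\in\mathbb R$, $\|x\|$ is the distance from $x$ to the nearest integer. For $(x_n)\subseteq[0,1]$, $R_2(s,N)=\frac1N\#\{(m,n):1\leqslant m,n\leqslant N,\ m\neq n,\ \|x_m-x_n\|\leqslant s/N\}$. The sequence has Poissonian pair correlations (PPC) if $\lim_{N\to\infty}R_2(s,N)=2s$ for all $s>0$. Uniform distribution mod $1$ means $\lim_{N\to\infty}\frac1N\#\{i\leqslant N:x_i\in[a,b]\}=b-a$ for all $0\leqslant a<b\leqslant1$. *)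

theory Defs
  imports "HOL-Analysis.Analysis"
begin

text \<open>
  Sequences \<open>(x\<^sub>n)\<close> are indexed by \<open>n \<ge> 1\<close>; they are modelled as functions
  on \<^typ>\<open>nat\<close> whose value at \<open>0\<close> is never used.
\<close>

definition dist_nearest_int :: "real \<Rightarrow> real" where
  "dist_nearest_int x = \<bar>x - of_int (round x)\<bar>"

definition pair_corr :: "(nat \<Rightarrow> real) \<Rightarrow> real \<Rightarrow> nat \<Rightarrow> real" where
  "pair_corr x s N =
     real (card {(m, n). m \<in> {1..N} \<and> n \<in> {1..N} \<and> m \<noteq> n \<and>
                         dist_nearest_int (x m - x n) \<le> s / real N}) / real N"

definition poissonian_pair_correlations :: "(nat \<Rightarrow> real) \<Rightarrow> bool" where
  "poissonian_pair_correlations x \<longleftrightarrow>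
     (\<forall>s>0. (\<lambda>N. pair_corr x s N) \<longlonglongrightarrow> 2 * s)"

text \<open>Only meant for sequences in \<open>[0,1]\<close>, so no fractional part is taken.\<close>

definition uniformly_distributed_mod1 :: "(nat \<Rightarrow> real) \<Rightarrow> bool" where
  "uniformly_distributed_mod1 x \<longleftrightarrow>
     (\<forall>a b. 0 \<le> a \<and> a < b \<and> b \<le> 1 \<longrightarrow>
        (\<lambda>N. real (card {i \<in> {1..N}. x i \<in> {a..b}}) / real N) \<longlonglongrightarrow> b - a)"

end

theory Submission
  imports Defs "HOL-Real_Asymp.Real_Asymp"
begin

text \<open>
  Interleave \<open>K\<close> van der Corput sequences whose bases are distinct primes. Among the first \<open>N\<close> terms,
  each of them is a union of \<open>O(log N)\<close> shifted lattices \<open>c + p\<^sup>-\<^sup>i\<int>\<close>. By the Chinese remainder theorem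
  the differences of two such lattices with coprime moduli \<open>P\<close>, \<open>Q\<close> again form a lattice of spacing
  \<open>1/(PQ)\<close>, so pairs from different sequences behave like independent points, with total error
  \<open>O(log\<^sup>2 N)\<close>. Two terms of the same sequence are at distance at least \<open>K/(3N)\<close>, so for small \<open>s\<close> they do not
  contribute at all. Hence the pair correlation is \<open>2 s (1 - 1/K)\<close>, and shrinking everything by the
  factor \<open>1 - 1/K\<close> restores \<open>2 s\<close> while leaving a gap of length \<open>1/K\<close> without points. For larger \<open>s\<close>
  the pairs from the same sequence do contribute, and the limit exceeds \<open>2 s\<close>.
\<close>

section \<open>Digit permutations with well separated initial segments\<close>

text \<open>
  In the plain van der Corput sequence of base \<open>b\<close> the minimal gap among the first \<open>n\<close> terms can be as
  small as about \<open>1/(b n)\<close>, which is not enough for \<open>K\<close> different prime bases. A greedy choice of the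
  digit permutation gives \<open>1/(3 n)\<close> for every base.
\<close>

lemma card_circular_ball_le:
  fixes b y k :: int
  assumes "0 \<le> y" "y < b" "0 \<le> k"
  shows "card {x \<in> {0..<b}. \<bar>y - x\<bar> \<le> k \<or> b - \<bar>y - x\<bar> \<le> k} \<le> nat (2 * k + 1)"
proof -
  let ?B = "{x \<in> {0..<b}. \<bar>y - x\<bar> \<le> k \<or> b - \<bar>y - x\<bar> \<le> k}"
  have "?B \<subseteq> (\<lambda>z. (y + z) mod b) ` {-k..k}"
  proof
    fix x assume x: "x \<in> ?B"
    then consider "\<bar>y - x\<bar> \<le> k" | "b - \<bar>y - x\<bar> \<le> k" "y \<le> x" | "b - \<bar>y - x\<bar> \<le> k" "x < y"
      by fastforce
    then show "x \<in> (\<lambda>z. (y + z) mod b) ` {-k..k}"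
    proof cases
      case 1
      then show ?thesis using x by (intro image_eqI[of _ _ "x - y"]) auto
    next
      case 2
      have "x = (y + (x - y - b)) mod b"
        using x mod_add_self2[of "x - b" b] by simp
      then show ?thesis using 2 x assms by (intro image_eqI[of _ _ "x - y - b"]) auto
    next
      case 3
      have "x = (y + (x - y + b)) mod b" using x by simp
      then show ?thesis using 3 x assms by (intro image_eqI[of _ _ "x - y + b"]) auto
    qed
  qed
  then have "card ?B \<le> card {-k..k}"
    by (meson card_image_le card_mono finite_atLeastAtMost_int finite_imageI order_trans)
  then show ?thesis by (simp add: algebra_simps)
qed

text \<open>The two inequalities keep \<open>f a\<close> and \<open>f c\<close> at circular distance
  at least \<open>b / (3 * c)\<close>. The values are chosen greedily: the circular balls around the
  earlier values do not cover all residues.\<close>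

lemma exists_spread_values:
  fixes b n :: nat
  assumes "1 \<le> n" "n \<le> b"
  shows "\<exists>f :: nat \<Rightarrow> int. (\<forall>a<n. 0 \<le> f a \<and> f a < b) \<and> f 0 = 0 \<and>
           (\<forall>c<n. \<forall>a<c. b \<le> 3 * c * \<bar>f a - f c\<bar> \<and> b \<le> 3 * c * (b - \<bar>f a - f c\<bar>))"
  using assms
proof (induction n rule: dec_induct)
  case base
  show ?case using assms by (intro exI[of _ "\<lambda>_. 0"]) auto
next
  case (step n)
  then obtain f :: "nat \<Rightarrow> int" where
    f: "\<And>a. a < n \<Longrightarrow> 0 \<le> f a \<and> f a < b" "f 0 = 0"
       "\<And>c a. c < n \<Longrightarrow> a < c \<Longrightarrow> b \<le> 3 * c * \<bar>f a - f c\<bar> \<and> b \<le> 3 * c * (b - \<bar>f a - f c\<bar>)"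
    by auto
  \<comment> \<open>The largest radius with \<open>3 * n * k < b\<close>; a value outside all balls
    of radius \<open>k\<close> has circular distance at least \<open>b / (3 * n)\<close> from the
    earlier ones.\<close>
  define k where "k = (int b - 1) div (3 * int n)"
  have n: "0 < int n" "int n < int b" using step by auto
  have k0: "0 \<le> k" unfolding k_def using n by (simp add: pos_imp_zdiv_nonneg_iff)
  have k_iff: "z \<le> k \<longleftrightarrow> 3 * int n * z < int b" for z
  proof -
    have "z \<le> k" if "z * (3 * int n) \<le> int b - 1"
      using zdiv_mono1[OF that, of "3 * int n"] n by (simp add: k_def)
    moreover have "z * (3 * int n) \<le> int b - 1" if "z \<le> k"
    proof -
      have "z * (3 * int n) \<le> k * (3 * int n)" using that n by (intro mult_right_mono) auto
      also have "\<dots> \<le> int b - 1"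
        using div_mult_mod_eq[of "int b - 1" "3 * int n"] n pos_mod_sign[of "3 * int n" "int b - 1"]
        unfolding k_def by linarith
      finally show ?thesis .
    qed
    ultimately show ?thesis by (auto simp: mult.commute)
  qed
  define B where "B y = {x \<in> {0..<int b}. \<bar>y - x\<bar> \<le> k \<or> b - \<bar>y - x\<bar> \<le> k}" for y
  have lt: "int n * (2 * k + 1) < int b"
  proof (cases "k = 0")
    case False
    then have "int n * (2 * k + 1) \<le> int n * (3 * k)" using k0 n by (intro mult_left_mono) auto
    also have "\<dots> < int b" using k_iff[of k] by (simp add: mult.assoc mult.left_commute)
    finally show ?thesis .
  qed (use n in auto)
  have "card (\<Union>a<n. B (f a)) \<le> (\<Sum>a<n. card (B (f a)))"
    by (rule card_UN_le) simp
  also have "\<dots> \<le> (\<Sum>a<n. nat (2 * k + 1))"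
    unfolding B_def using f(1) k0 by (intro sum_mono card_circular_ball_le) auto
  also have "\<dots> = nat (int n * (2 * k + 1))" using k0 by (simp add: nat_mult_distrib)
  also have "\<dots> < card {0..<int b}" using lt n by (simp add: nat_less_iff)
  finally have "card (\<Union>a<n. B (f a)) < card {0..<int b}" .
  moreover have "finite (\<Union>a<n. B (f a))" 
    unfolding B_def by (rule finite_subset[of _ "{0..<int b}"]) auto
  ultimately have "\<not> {0..<int b} \<subseteq> (\<Union>a<n. B (f a))" by (meson card_mono not_le)
  then obtain x where x: "0 \<le> x" "x < int b" "\<And>a. a < n \<Longrightarrow> x \<notin> B (f a)"
    by (auto simp: subset_iff)
  have sep: "b \<le> 3 * n * \<bar>f a - x\<bar> \<and> b \<le> 3 * n * (b - \<bar>f a - x\<bar>)" if "a < n" for a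
    using x(3)[OF that] x(1,2) unfolding B_def by (auto simp: k_iff not_less)
  show ?case
    using f x(1,2) sep step
    by (intro exI[of _ "f(n := x)"]) (auto simp: less_Suc_eq)
qed

text \<open>The greedy choice run up to \<open>n = b\<close>. Equal values would give
  \<open>b \<le> 0\<close>, so the values are distinct and permute the digits.\<close>

lemma exists_spread_permutation:
  fixes b :: nat
  assumes "1 \<le> b"
  shows "\<exists>\<sigma> :: nat \<Rightarrow> nat. inj_on \<sigma> {..<b} \<and> \<sigma> ` {..<b} \<subseteq> {..<b} \<and> \<sigma> 0 = 0 \<and>
           (\<forall>c<b. \<forall>a<c. real b \<le> 3 * c * \<bar>real (\<sigma> a) - real (\<sigma> c)\<bar> \<and>
                        real b \<le> 3 * c * (real b - \<bar>real (\<sigma> a) - real (\<sigma> c)\<bar>))"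
proof -
  obtain f :: "nat \<Rightarrow> int" where
    f: "\<And>a. a < b \<Longrightarrow> 0 \<le> f a \<and> f a < b" "f 0 = 0"
       "\<And>c a. c < b \<Longrightarrow> a < c \<Longrightarrow> b \<le> 3 * c * \<bar>f a - f c\<bar> \<and> b \<le> 3 * c * (b - \<bar>f a - f c\<bar>)"
    using exists_spread_values[of b b] assms by auto
  have "f a \<noteq> f c" if "c < b" "a < c" for a c using f(3)[OF that] assms by auto
  then have inj: "inj_on f {..<b}" by (metis inj_onI lessThan_iff linorder_neqE_nat)
  have r: "real (nat (f a)) = of_int (f a)" if "a < b" for a using f(1)[OF that] by simp
  have "real b \<le> 3 * c * \<bar>real (nat (f a)) - real (nat (f c))\<bar> \<and>
        real b \<le> 3 * c * (real b - \<bar>real (nat (f a)) - real (nat (f c))\<bar>)" if c: "c < b" "a < c" for a c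
  proof -
    have "real_of_int (int b) \<le> real_of_int (3 * int c * \<bar>f a - f c\<bar>)"
      and "real_of_int (int b) \<le> real_of_int (3 * int c * (b - \<bar>f a - f c\<bar>))"
      using f(3)[OF c] by (simp_all only: of_int_le_iff)
    then show ?thesis using c by (simp add: r)
  qed
  moreover have "inj_on (\<lambda>a. nat (f a)) {..<b}"
    using inj f(1) by (auto simp: inj_on_def eq_nat_nat_iff)
  ultimately show ?thesis using f by (intro exI[of _ "\<lambda>a. nat (f a)"]) (auto simp: nat_less_iff)
qed

section \<open>Permuted van der Corput sequences\<close>

text \<open>The radical inverse of \<open>n\<close> in base \<open>b\<close>, each digit first
  replaced through \<open>\<sigma>\<close>. The guard makes the recursion terminate.\<close>

fun corput :: "(nat \<Rightarrow> nat) \<Rightarrow> nat \<Rightarrow> nat \<Rightarrow> real" where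
  "corput \<sigma> b n = (if n = 0 \<or> b < 2 then 0
     else (real (\<sigma> (n mod b)) + corput \<sigma> b (n div b)) / real b)"

declare corput.simps [simp del]

context
  fixes \<sigma> :: "nat \<Rightarrow> nat" and b :: nat
  assumes b: "2 \<le> b" and inj: "inj_on \<sigma> {..<b}" and range: "\<sigma> ` {..<b} \<subseteq> {..<b}"
    and zero: "\<sigma> 0 = 0"
begin

lemma corput_0: "corput \<sigma> b 0 = 0"
  by (subst corput.simps) simp

text \<open>Since \<open>\<sigma> 0 = 0\<close>, leading zeros contribute nothing and the recursion
  also holds at \<open>n = 0\<close>.\<close>

lemma corput_rec: "corput \<sigma> b n = (real (\<sigma> (n mod b)) + corput \<sigma> b (n div b)) / real b"
proof (cases "n = 0")
  case False
  then show ?thesis using b by (subst corput.simps) simp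
qed (simp add: corput_0 zero)

text \<open>The low digits \<open>r\<close> fill the first \<open>i\<close> places after the radix
  point, and the high digits \<open>a\<close> are pushed back by \<open>i\<close> places.\<close>

lemma corput_append_digits:
  assumes "r < b ^ i"
  shows "corput \<sigma> b (a * b ^ i + r) = corput \<sigma> b r + corput \<sigma> b a / b ^ i"
  using assms
proof (induction i arbitrary: r)
  case 0
  then show ?case by (simp add: corput_0)
next
  case (Suc i)
  have eq: "a * b ^ Suc i + r = b * (a * b ^ i) + r" by simp
  have "(a * b ^ Suc i + r) mod b = r mod b" "(a * b ^ Suc i + r) div b = a * b ^ i + r div b"
    unfolding eq using b by simp_all
  moreover have "r div b < b ^ i" using Suc.prems b by (simp add: less_mult_imp_div_less mult.commute)
  ultimately show ?case
    using Suc.IH[of "r div b"] corput_rec[of "a * b ^ Suc i + r"] corput_rec[of r]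
    by (simp add: add_divide_distrib divide_divide_eq_left mult.commute)
qed

text \<open>Reversing \<open>i\<close> digits and permuting each of them permutes the numbers below
  \<open>b ^ i\<close>.\<close>

lemma corput_lattice:
  "\<exists>\<pi>. bij_betw \<pi> {..<b ^ i} {..<b ^ i} \<and> (\<forall>r<b ^ i. corput \<sigma> b r = real (\<pi> r) / b ^ i)"
proof (induction i)
  case 0
  show ?case by (intro exI[of _ id]) (auto simp: corput_0 bij_betw_def)
next
  case (Suc i)
  then obtain \<pi> where \<pi>: "bij_betw \<pi> {..<b ^ i} {..<b ^ i}"
    "\<And>r. r < b ^ i \<Longrightarrow> corput \<sigma> b r = real (\<pi> r) / b ^ i" by auto
  \<comment> \<open>The lowest digit of \<open>r\<close> becomes the leading one; quotient and
    remainder by \<open>b ^ i\<close> recover both parts, whence injectivity.\<close>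
  define \<rho> where "\<rho> r = \<sigma> (r mod b) * b ^ i + \<pi> (r div b)" for r
  have div: "r div b < b ^ i" if "r < b ^ Suc i" for r
    using that b by (simp add: less_mult_imp_div_less mult.commute)
  have \<pi>_lt: "\<pi> r < b ^ i" if "r < b ^ i" for r using \<pi>(1) that by (auto dest: bij_betwE)
  have \<sigma>_lt: "\<sigma> (r mod b) < b" for r using range b by (force simp: image_subset_iff)
  have "\<rho> ` {..<b ^ Suc i} \<subseteq> {..<b ^ Suc i}"
  proof safe
    fix r assume "r < b ^ Suc i"
    then have "\<rho> r < (\<sigma> (r mod b) + 1) * b ^ i" unfolding \<rho>_def using \<pi>_lt div by simp
    also have "\<dots> \<le> b * b ^ i" using \<sigma>_lt by (intro mult_right_mono) (auto simp: Suc_le_eq)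
    finally show "\<rho> r < b ^ Suc i" by simp
  qed
  moreover have "inj_on \<rho> {..<b ^ Suc i}"
  proof (rule inj_onI)
    fix r s assume r: "r \<in> {..<b ^ Suc i}" and s: "s \<in> {..<b ^ Suc i}" and eq: "\<rho> r = \<rho> s"
    have 1: "\<rho> x mod b ^ i = \<pi> (x div b)" "\<rho> x div b ^ i = \<sigma> (x mod b)" if "x < b ^ Suc i" for x
      using \<pi>_lt[OF div[OF that]] b by (simp_all add: \<rho>_def)
    have "\<pi> (r div b) = \<pi> (s div b)" "\<sigma> (r mod b) = \<sigma> (s mod b)"
      using 1[of r] 1[of s] r s eq by auto
    moreover have "r div b < b ^ i" "s div b < b ^ i" using r s div by auto
    ultimately have "r div b = s div b" "r mod b = s mod b"
      using \<pi>(1) inj b by (auto simp: bij_betw_def dest!: inj_onD)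
    then show "r = s" by (metis div_mult_mod_eq)
  qed
  ultimately have "bij_betw \<rho> {..<b ^ Suc i} {..<b ^ Suc i}"
    by (simp add: bij_betw_def endo_inj_surj)
  moreover have "corput \<sigma> b r = real (\<rho> r) / b ^ Suc i" if "r < b ^ Suc i" for r
    using corput_rec[of r] \<pi>(2)[OF div[OF that]] b by (simp add: \<rho>_def field_simps)
  ultimately show ?case by blast
qed

lemma corput_bounds: "0 \<le> corput \<sigma> b n" "corput \<sigma> b n < 1"
proof -
  have n: "n < b ^ n" using b by (simp add: power_gt_expt)
  obtain \<pi> where "bij_betw \<pi> {..<b ^ n} {..<b ^ n}" "\<forall>r<b ^ n. corput \<sigma> b r = real (\<pi> r) / b ^ n"
    using corput_lattice by blast
  with n have "corput \<sigma> b n = real (\<pi> n) / b ^ n" "\<pi> n < b ^ n" by (auto dest: bij_betwE)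
  moreover from this(2) have "real (\<pi> n) < real b ^ n" by (metis of_nat_less_iff of_nat_power)
  ultimately show "0 \<le> corput \<sigma> b n" "corput \<sigma> b n < 1"
    using b by (simp_all del: of_nat_less_of_nat_power_cancel_iff)
qed

text \<open>The indices of the block share the high digits \<open>a\<close>, so their values form a
  lattice of spacing \<open>1 / b ^ i\<close> shifted by
  \<open>corput \<sigma> b a / b ^ i\<close>.\<close>

lemma sum_corput_block:
  fixes g :: "real \<Rightarrow> real"
  shows "(\<Sum>n\<in>{a * b ^ i..<Suc a * b ^ i}. g (corput \<sigma> b n)) =
         (\<Sum>j<b ^ i. g ((real j + corput \<sigma> b a) / b ^ i))"
proof -
  obtain \<pi> where \<pi>: "bij_betw \<pi> {..<b ^ i} {..<b ^ i}"
    "\<forall>r<b ^ i. corput \<sigma> b r = real (\<pi> r) / b ^ i" using corput_lattice by blast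
  have "(\<Sum>n\<in>{a * b ^ i..<Suc a * b ^ i}. g (corput \<sigma> b n)) =
        (\<Sum>r<b ^ i. g (corput \<sigma> b (a * b ^ i + r)))"
    by (rule sum.reindex_bij_witness[of _ "\<lambda>r. a * b ^ i + r" "\<lambda>n. n - a * b ^ i"]) auto
  also have "\<dots> = (\<Sum>r<b ^ i. g ((real (\<pi> r) + corput \<sigma> b a) / b ^ i))"
    by (intro sum.cong) (auto simp: corput_append_digits \<pi>(2) add_divide_distrib)
  also have "\<dots> = (\<Sum>j<b ^ i. g ((real j + corput \<sigma> b a) / b ^ i))"
    by (rule sum.reindex_bij_betw[OF \<pi>(1)])
  finally show ?thesis .
qed

text \<open>Let \<open>k\<close> be the leading position of \<open>n\<close>. Times
  \<open>b ^ (k + 1)\<close>, the difference is a multiple of \<open>b\<close>, coming from the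
  digits below \<open>k\<close>, plus the difference of the permuted digits at \<open>k\<close>. The
  ordinary distance of these digits serves if the multiple vanishes, the circular one
  otherwise.\<close>

lemma corput_separated:
  assumes sep: "\<And>a c. c < b \<Longrightarrow> a < c \<Longrightarrow> real b \<le> 3 * c * \<bar>real (\<sigma> a) - real (\<sigma> c)\<bar> \<and>
                   real b \<le> 3 * c * (real b - \<bar>real (\<sigma> a) - real (\<sigma> c)\<bar>)"
    and mn: "m < n"
  shows "1 / (3 * real n) \<le> \<bar>corput \<sigma> b m - corput \<sigma> b n\<bar>"
proof -
  obtain k where k: "b ^ k \<le> n" "n < b ^ (k + 1)" using ex_power_ivl1[of b n] b mn by auto
  obtain \<pi> where \<pi>: "bij_betw \<pi> {..<b ^ k} {..<b ^ k}"
    "\<And>r. r < b ^ k \<Longrightarrow> corput \<sigma> b r = real (\<pi> r) / b ^ k" using corput_lattice by blast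
  define d where "d = n div b ^ k"
  define a where "a = m div b ^ k"
  have B: "0 < b ^ k" using b by simp
  have d: "1 \<le> d" "d < b"
    using k B by (auto simp: d_def less_mult_imp_div_less Suc_le_eq div_greater_zero_iff)
  have ad: "a \<le> d" unfolding a_def d_def using mn by (simp add: div_le_mono)
  have digit: "corput \<sigma> b q = real (\<sigma> q) / b" if "q < b" for q
    using corput_rec[of q] that by (simp add: corput_0)
  have val: "b ^ Suc k * corput \<sigma> b q = b * real (\<pi> (q mod b ^ k)) + \<sigma> (q div b ^ k)"
    if "q div b ^ k < b" for q
    using corput_append_digits[of "q mod b ^ k" k "q div b ^ k"] digit[OF that] \<pi>(2)[of "q mod b ^ k"] B b
    by (simp add: field_simps)
  define \<Delta> where "\<Delta> = real b * (real (\<pi> (m mod b ^ k)) - real (\<pi> (n mod b ^ k))) + (real (\<sigma> a) - real (\<sigma> d))"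
  have eq: "b ^ Suc k * (corput \<sigma> b m - corput \<sigma> b n) = \<Delta>"
    using val[of m] val[of n] ad d by (simp add: \<Delta>_def a_def d_def right_diff_distrib)
  have "real b \<le> 3 * d * \<bar>\<Delta>\<bar>"
  proof (cases "\<pi> (m mod b ^ k) = \<pi> (n mod b ^ k)")
    case True
    then have "m mod b ^ k = n mod b ^ k" using \<pi>(1) B by (auto simp: bij_betw_def dest!: inj_onD)
    then have "a < d" using mn ad unfolding a_def d_def by (metis div_mult_mod_eq less_irrefl order_le_less)
    then show ?thesis using True sep[of d a] d by (simp add: \<Delta>_def)
  next
    case False
    then have "1 \<le> \<bar>real (\<pi> (m mod b ^ k)) - real (\<pi> (n mod b ^ k))\<bar>" by linarith
    then have "real b * 1 \<le> \<bar>real b * (real (\<pi> (m mod b ^ k)) - real (\<pi> (n mod b ^ k)))\<bar>"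
      unfolding abs_mult using b by (intro mult_mono) auto
    then have *: "real b - \<bar>real (\<sigma> a) - real (\<sigma> d)\<bar> \<le> \<bar>\<Delta>\<bar>" unfolding \<Delta>_def by linarith
    have "real b \<le> 3 * d * (real b - \<bar>real (\<sigma> a) - real (\<sigma> d)\<bar>)"
    proof (cases "a = d")
      case True
      have "1 * real b \<le> (3 * real d) * real b" using d by (intro mult_right_mono) auto
      then show ?thesis using True by simp
    qed (use sep[of d a] d ad in auto)
    also have "\<dots> \<le> 3 * d * \<bar>\<Delta>\<bar>" using * by (intro mult_left_mono) auto
    finally show ?thesis .
  qed
  also have "3 * d * \<bar>\<Delta>\<bar> = real b * (3 * real (d * b ^ k) * \<bar>corput \<sigma> b m - corput \<sigma> b n\<bar>)"
    unfolding eq[symmetric] abs_mult by simp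
  finally have "1 \<le> 3 * real (d * b ^ k) * \<bar>corput \<sigma> b m - corput \<sigma> b n\<bar>" using b by simp
  \<comment> \<open>Here \<open>d * b ^ k \<le> n\<close> turns the bound for the leading digit into
    one for \<open>n\<close>.\<close>
  also have "\<dots> \<le> 3 * real n * \<bar>corput \<sigma> b m - corput \<sigma> b n\<bar>"
    by (intro mult_right_mono mult_left_mono) (auto simp: d_def simp del: of_nat_mult)
  finally show ?thesis using mn by (simp add: field_simps)
qed

end


text \<open>An interface for the rest of the argument: range, digit concatenation, lattice blocks
  and separation. The digit permutation behind \<open>v\<close> is forgotten.\<close>

definition separated_corput :: "nat \<Rightarrow> (nat \<Rightarrow> real) \<Rightarrow> bool" where
  "separated_corput b v \<longleftrightarrow>
     (\<forall>n. 0 \<le> v n \<and> v n < 1) \<and>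
     (\<forall>a i r. r < b ^ i \<longrightarrow> v (a * b ^ i + r) = v r + v a / b ^ i) \<and>
     (\<forall>a i (g :: real \<Rightarrow> real).
        (\<Sum>n\<in>{a * b ^ i..<Suc a * b ^ i}. g (v n)) = (\<Sum>j<b ^ i. g ((real j + v a) / b ^ i))) \<and>
     (\<forall>m n. m < n \<longrightarrow> 1 / (3 * real n) \<le> \<bar>v m - v n\<bar>)"

lemma exists_separated_corput:
  assumes "2 \<le> b"
  shows "\<exists>v. separated_corput b v"
proof -
  obtain \<sigma> :: "nat \<Rightarrow> nat" where \<sigma>: "inj_on \<sigma> {..<b}" "\<sigma> ` {..<b} \<subseteq> {..<b}" "\<sigma> 0 = 0"
    "\<And>a c. c < b \<Longrightarrow> a < c \<Longrightarrow> real b \<le> 3 * c * \<bar>real (\<sigma> a) - real (\<sigma> c)\<bar> \<and>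
        real b \<le> 3 * c * (real b - \<bar>real (\<sigma> a) - real (\<sigma> c)\<bar>)"
    using exists_spread_permutation[of b] assms by auto
  show ?thesis
    unfolding separated_corput_def
    using corput_bounds[OF assms \<sigma>(1-3)] corput_append_digits[OF assms \<sigma>(1-3)]
      sum_corput_block[OF assms \<sigma>(1-3)] corput_separated[OF assms \<sigma>(1-3) \<sigma>(4)]
    by (intro exI[of _ "corput \<sigma> b"]) (intro conjI allI impI; blast)
qed

section \<open>Pairs from two coprime lattices\<close>

lemma card_int_ball:
  fixes \<delta> B :: real
  assumes "0 \<le> B"
  shows "finite {z :: int. \<bar>z + \<delta>\<bar> \<le> B}" "\<bar>real (card {z :: int. \<bar>z + \<delta>\<bar> \<le> B}) - 2 * B\<bar> \<le> 1"
proof -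
  have eq: "{z :: int. \<bar>z + \<delta>\<bar> \<le> B} = {\<lceil>- B - \<delta>\<rceil>..\<lfloor>B - \<delta>\<rfloor>}"
    by (auto simp: abs_le_iff ceiling_le_iff le_floor_iff)
  show "finite {z :: int. \<bar>z + \<delta>\<bar> \<le> B}" unfolding eq by simp
  have "real_of_int (\<lfloor>B - \<delta>\<rfloor> - \<lceil>- B - \<delta>\<rceil> + 1) > -1" using assms by linarith
  then have "\<lfloor>B - \<delta>\<rfloor> - \<lceil>- B - \<delta>\<rceil> + 1 \<ge> 0" by linarith
  then have "real (card {z :: int. \<bar>z + \<delta>\<bar> \<le> B}) = real_of_int (\<lfloor>B - \<delta>\<rfloor> - \<lceil>- B - \<delta>\<rceil> + 1)"
    unfolding eq by (simp add: add.commute)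
  then show "\<bar>real (card {z :: int. \<bar>z + \<delta>\<bar> \<le> B}) - 2 * B\<bar> \<le> 1" by linarith
qed

text \<open>Chinese remainder theorem for the numerators of \<open>i / P - j / Q\<close> over
  \<open>P * Q\<close>: the residue modulo \<open>P\<close> determines \<open>i\<close>, that modulo
  \<open>Q\<close> determines \<open>j\<close>, and counting gives surjectivity.\<close>

lemma coprime_residues_bij:
  fixes P Q :: nat
  assumes "coprime P Q" "0 < P" "0 < Q"
  shows "bij_betw (\<lambda>(i, j). (int i * Q - int j * P) mod (int P * Q)) ({..<P} \<times> {..<Q}) {0..<int P * Q}"
proof -
  let ?F = "\<lambda>(i :: nat, j :: nat). (int i * Q - int j * P) mod (int P * Q)"
  have cop: "coprime (int P) (int Q)" using assms(1) by simp
  have inj: "inj_on ?F ({..<P} \<times> {..<Q})"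
  proof (rule inj_onI, clarify)
    fix i j i' j'
    assume lt: "i < P" "j < Q" "i' < P" "j' < Q"
      and "(int i * Q - int j * P) mod (int P * Q) = (int i' * Q - int j' * P) mod (int P * Q)"
    then have dvd: "int P * Q dvd (int i * Q - int j * P) - (int i' * Q - int j' * P)"
      by (simp add: mod_eq_dvd_iff)
    have eq: "(int i * Q - int j * P) - (int i' * Q - int j' * P) =
        (int i - int i') * Q - (int j - int j') * P" by (simp add: algebra_simps)
    have "int P dvd (int i - int i') * Q"
      using dvd_mult_left[OF dvd] unfolding eq by (simp add: dvd_diff_left_iff)
    then have "int P dvd int i - int i'" using cop by (simp add: coprime_dvd_mult_left_iff)
    then have 1: "i = i'" using lt zdvd_imp_le[of "int P" "\<bar>int i - int i'\<bar>"] by fastforce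
    have "int Q dvd (int j - int j') * P"
      using dvd_mult_right[OF dvd] unfolding eq by (simp add: dvd_diff_right_iff)
    then have "int Q dvd int j - int j'" using cop by (simp add: coprime_dvd_mult_left_iff coprime_commute)
    then have "j = j'" using lt zdvd_imp_le[of "int Q" "\<bar>int j - int j'\<bar>"] by fastforce
    with 1 show "i = i' \<and> j = j'" by simp
  qed
  have "?F ` ({..<P} \<times> {..<Q}) \<subseteq> {0..<int P * Q}" using assms by auto
  moreover have "card (?F ` ({..<P} \<times> {..<Q})) = card {0..<int P * Q}"
    using card_image[OF inj] by (simp add: nat_mult_distrib)
  ultimately have "?F ` ({..<P} \<times> {..<Q}) = {0..<int P * Q}" by (intro card_subset_eq) auto
  with inj show ?thesis by (simp add: bij_betw_def)
qed

lemma card_lattice_near_ends: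
  fixes P :: nat and u t :: real
  assumes "0 < P" "0 \<le> u" "u < 1" "0 \<le> t"
  shows "real (card {i \<in> {..<P}. (i + u) / P \<le> t}) \<le> t * P + 1"
    and "real (card {i \<in> {..<P}. 1 - t \<le> (i + u) / P}) \<le> t * P + 1"
proof -
  have tP: "0 \<le> t * P" using assms by simp
  have "{i \<in> {..<P}. (i + u) / P \<le> t} \<subseteq> {..nat \<lfloor>t * P\<rfloor>}"
    using assms tP by (auto simp: divide_simps le_nat_floor)
  then have "card {i \<in> {..<P}. (i + u) / P \<le> t} \<le> nat \<lfloor>t * P\<rfloor> + 1"
    using card_mono[of "{..nat \<lfloor>t * P\<rfloor>}"] by fastforce
  then show "real (card {i \<in> {..<P}. (i + u) / P \<le> t}) \<le> t * P + 1"
    using of_nat_floor[OF tP] by linarith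
  \<comment> \<open>The reflection \<open>P - 1 - i\<close> moves the right end to the left
    one.\<close>
  have "(\<lambda>i. P - 1 - i) ` {i \<in> {..<P}. 1 - t \<le> (i + u) / P} \<subseteq> {..nat \<lfloor>t * P\<rfloor>}"
  proof safe
    fix i assume i: "i < P" "1 - t \<le> (i + u) / P"
    then have "real P - t * P \<le> i + u" using assms by (simp add: field_simps)
    then have "real (P - 1 - i) \<le> t * P" using i assms by (simp add: of_nat_diff)
    then show "P - 1 - i \<le> nat \<lfloor>t * P\<rfloor>" by (rule le_nat_floor)
  qed
  moreover have "inj_on (\<lambda>i. P - 1 - i) {i \<in> {..<P}. 1 - t \<le> (i + u) / P}"
    by (auto simp: inj_on_def)
  ultimately have "card {i \<in> {..<P}. 1 - t \<le> (i + u) / P} \<le> card {..nat \<lfloor>t * P\<rfloor>}"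
    by (intro card_inj_on_le[of "\<lambda>i. P - 1 - i"]) auto
  then show "real (card {i \<in> {..<P}. 1 - t \<le> (i + u) / P}) \<le> t * P + 1"
    using of_nat_floor[OF tP] by simp
qed

text \<open>Times \<open>P * Q\<close>, the differences are \<open>D p + \<delta>\<close>, where
  \<open>D\<close> meets every residue modulo \<open>P * Q\<close> once. The set \<open>I\<close>
  has \<open>2 * t * P * Q\<close> integers up to an error of 1, and it matches the close pairs
  except for pairs near opposite ends of the unit interval.\<close>

lemma lattice_pair_discrepancy:
  fixes P Q :: nat and u w t T :: real
  assumes cop: "coprime P Q" and pos: "0 < P" "0 < Q"
    and u: "0 \<le> u" "u < 1" and w: "0 \<le> w" "w < 1"
    and t: "0 \<le> t" "t < 1/2" and T: "t * P \<le> T" "t * Q \<le> T"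
  shows "\<bar>\<Sum>i<P. \<Sum>j<Q. (of_bool (\<bar>(i + u) / P - (j + w) / Q\<bar> \<le> t) - 2 * t)\<bar> \<le> 1 + 2 * (T + 1)\<^sup>2"
proof -
  define A where "A = {..<P} \<times> {..<Q}"
  define d where "d = (\<lambda>(i :: nat, j :: nat). (i + u) / P - (j + w) / Q)"
  define D where "D = (\<lambda>(i :: nat, j :: nat). int i * Q - int j * P)"
  define \<delta> where "\<delta> = u * Q - w * P"
  define X where "X = {p \<in> A. \<bar>d p\<bar> \<le> t}"
  \<comment> \<open>The pairs that are close only after wrapping around modulo 1.\<close>
  define W where "W = {p \<in> A. 1 - t \<le> \<bar>d p\<bar>}"
  define I where "I = {z :: int. \<bar>z + \<delta>\<bar> \<le> t * (real P * Q)}"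
  have PQ: "0 < real P * Q" using pos by simp
  have fin: "finite A" by (simp add: A_def)
  have bij: "bij_betw (\<lambda>p. D p mod (int P * Q)) A {0..<int P * Q}"
    using coprime_residues_bij[OF cop pos] unfolding A_def D_def by (simp add: case_prod_unfold)
  have dD: "d p * (real P * Q) = D p + \<delta>" for p
    using pos by (cases p) (simp add: d_def D_def \<delta>_def field_simps)
  have absdD: "\<bar>d p\<bar> * (real P * Q) = \<bar>D p + \<delta>\<bar>" for p
    using dD[of p] PQ by (metis abs_mult abs_of_pos)
  have I: "finite I" "\<bar>real (card I) - 2 * (t * (real P * Q))\<bar> \<le> 1"
    unfolding I_def using card_int_ball[of "t * (real P * Q)" \<delta>] t PQ by auto
  have "(\<Sum>i<P. \<Sum>j<Q. (of_bool (\<bar>(i + u) / P - (j + w) / Q\<bar> \<le> t) - 2 * t)) =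
        (\<Sum>p\<in>A. of_bool (\<bar>d p\<bar> \<le> t) - 2 * t)"
    unfolding A_def d_def by (simp add: sum.cartesian_product case_prod_unfold)
  also have "\<dots> = real (card X) - 2 * (t * (real P * Q))"
    unfolding X_def using fin by (simp add: sum_subtractf A_def Collect_conj_eq Int_commute mult.left_commute)
  finally have sum_eq: "(\<Sum>i<P. \<Sum>j<Q. (of_bool (\<bar>(i + u) / P - (j + w) / Q\<bar> \<le> t) - 2 * t)) =
        real (card X) - 2 * (t * (real P * Q))" .
  have X_iff: "p \<in> X \<longleftrightarrow> p \<in> A \<and> D p \<in> I" for p
    unfolding X_def I_def using mult_le_cancel_right_pos[OF PQ, of "\<bar>d p\<bar>" t]
    by (simp add: absdD[symmetric])
  have upper: "card X \<le> card I"
  proof (rule card_inj_on_le[of D])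
    show "inj_on D X"
      using bij X_iff unfolding bij_betw_def inj_on_def by metis
  qed (use X_iff I in auto)
  have "card I \<le> card (X \<union> W)"
  proof (rule card_inj_on_le)
    \<comment> \<open>\<open>h\<close> inverts \<open>D\<close> modulo \<open>P Q\<close>; it inverts \<open>D\<close> itself except where the difference wraps around.\<close>
    define h where "h z = inv_into A (\<lambda>p. D p mod (int P * Q)) (z mod (int P * Q))" for z
    have h: "h z \<in> A" "D (h z) mod (int P * Q) = z mod (int P * Q)" for z
    proof -
      have "z mod (int P * Q) \<in> (\<lambda>p. D p mod (int P * Q)) ` A"
        using bij pos unfolding bij_betw_def
        by (metis atLeastLessThan_iff mult_pos_pos of_nat_0_less_iff pos_mod_bound pos_mod_sign)
      from inv_into_into[OF this] f_inv_into_f[OF this]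
      show "h z \<in> A" "D (h z) mod (int P * Q) = z mod (int P * Q)" by (auto simp: h_def)
    qed
    have far: "real P * Q \<le> \<bar>real_of_int x - real_of_int y\<bar>"
      if "x mod (int P * Q) = y mod (int P * Q)" "x \<noteq> y" for x y
    proof -
      have "int P * Q dvd \<bar>x - y\<bar>" using that by (simp add: mod_eq_dvd_iff)
      then have "int P * Q \<le> \<bar>x - y\<bar>" using that by (intro zdvd_imp_le) auto
      then have "real_of_int (int P * Q) \<le> real_of_int \<bar>x - y\<bar>" by (simp only: of_int_le_iff)
      then show ?thesis by simp
    qed
    \<comment> \<open>Since \<open>t < 1/2\<close>, the interval defining \<open>I\<close> is
      shorter than one period, so its elements have distinct residues.\<close>
    show "inj_on h I"
    proof (rule inj_onI, rule ccontr)
      fix x y assume xy: "x \<in> I" "y \<in> I" "h x = h y" "x \<noteq> y"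
      then have "real P * Q \<le> \<bar>real_of_int x - real_of_int y\<bar>" using h(2) by (intro far) metis+
      also have "\<dots> \<le> 2 * t * (real P * Q)" using xy unfolding I_def by simp
      also have "\<dots> < 1 * (real P * Q)" using t PQ by (intro mult_strict_right_mono) auto
      finally show False by simp
    qed
    show "h ` I \<subseteq> X \<union> W"
    proof (rule image_subsetI)
      fix z assume z: "z \<in> I"
      show "h z \<in> X \<union> W"
      proof (cases "D (h z) = z")
        case True
        with z h(1) show ?thesis by (simp add: X_iff)
      next
        case False
        then have "real P * Q \<le> \<bar>real_of_int (D (h z)) - real_of_int z\<bar>" using h(2) by (intro far)
        then have "(1 - t) * (real P * Q) \<le> \<bar>d (h z)\<bar> * (real P * Q)"
          using z unfolding absdD I_def by (simp add: left_diff_distrib)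
        then have "1 - t \<le> \<bar>d (h z)\<bar>" using PQ by (rule mult_right_le_imp_le)
        with h(1) show ?thesis by (simp add: W_def)
      qed
    qed
  qed (use fin in \<open>auto simp: X_def W_def\<close>)
  also have "\<dots> \<le> card X + card W" by (rule card_Un_le)
  finally have lower: "card I \<le> card X + card W" .
  define L R where "L p x = {i \<in> {..<p}. (i + x) / p \<le> t}" and "R p x = {i \<in> {..<p}. 1 - t \<le> (i + x) / p}"
    for p :: nat and x :: real
  have range: "0 \<le> (real i + x) / p \<and> (real i + x) / p < 1" if "i < p" "0 \<le> x" "x < 1" for i p :: nat and x
  proof -
    have "real i + 1 \<le> real p" using that by linarith
    then show ?thesis using that by (simp add: divide_simps)
  qed
  \<comment> \<open>Both points lie between 0 and 1, so a difference of at least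
    \<open>1 - t\<close> puts one within \<open>t\<close> of 0 and the other within \<open>t\<close>
    of 1.\<close>
  have "W \<subseteq> L P u \<times> R Q w \<union> R P u \<times> L Q w"
  proof
    fix p assume "p \<in> W"
    then obtain i j where ij: "p = (i, j)" "i < P" "j < Q" "1 - t \<le> \<bar>(i + u) / P - (j + w) / Q\<bar>"
      by (auto simp: W_def A_def d_def)
    have "(i + u) / P \<le> t \<and> 1 - t \<le> (j + w) / Q \<or> 1 - t \<le> (i + u) / P \<and> (j + w) / Q \<le> t"
      using range[OF ij(2) u] range[OF ij(3) w] ij(4) by argo
    then show "p \<in> L P u \<times> R Q w \<union> R P u \<times> L Q w"
      using ij(1-3) by (auto simp: L_def R_def)
  qed
  then have "card W \<le> card (L P u \<times> R Q w \<union> R P u \<times> L Q w)"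
    by (intro card_mono) (auto simp: L_def R_def)
  also have "\<dots> \<le> card (L P u) * card (R Q w) + card (R P u) * card (L Q w)"
    by (metis card_Un_le card_cartesian_product)
  finally have "real (card W) \<le> real (card (L P u)) * card (R Q w) + real (card (R P u)) * card (L Q w)"
    by (metis of_nat_add of_nat_le_iff of_nat_mult)
  also have "\<dots> \<le> (T + 1) * (T + 1) + (T + 1) * (T + 1)"
  proof -
    have "real (card (L P u)) \<le> T + 1" "real (card (R P u)) \<le> T + 1"
      "real (card (L Q w)) \<le> T + 1" "real (card (R Q w)) \<le> T + 1"
      using card_lattice_near_ends[OF pos(1) u t(1)] card_lattice_near_ends[OF pos(2) w t(1)] T
      unfolding L_def R_def by linarith+
    then show ?thesis by (intro add_mono mult_mono) auto
  qed
  finally have "real (card W) \<le> 2 * (T + 1)\<^sup>2" by (simp add: power2_eq_square)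
  then show ?thesis unfolding sum_eq using upper lower I(2) by linarith
qed

section \<open>Pairs from two sequences with coprime bases\<close>

text \<open>Cut the range along the base \<open>b\<close> digits of \<open>r\<close>: each of the
  \<open>k\<close> digits accounts for fewer than \<open>b\<close> blocks, and only blocks of length
  at most \<open>r\<close> occur.\<close>

lemma sum_prefix_bound:
  fixes f :: "nat \<Rightarrow> real" and b R r :: nat and C :: real
  assumes "0 < b" "0 \<le> C"
    and block: "\<And>a i. b ^ i \<le> R \<Longrightarrow> \<bar>sum f {a * b ^ i..<Suc a * b ^ i}\<bar> \<le> C"
    and "r < b ^ k" "r \<le> R"
  shows "\<bar>sum f {a * b ^ k..<a * b ^ k + r}\<bar> \<le> k * b * C"
  using assms(4,5)
proof (induction k arbitrary: a r)
  case (Suc k)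
  define d where "d = r div b ^ k"
  define A where "A = a * b"
  have r: "r = d * b ^ k + r mod b ^ k" unfolding d_def by (rule div_mult_mod_eq[symmetric])
  have d: "d < b" using Suc.prems by (simp add: d_def less_mult_imp_div_less)
  have "\<bar>sum f {A * b ^ k..<(A + e) * b ^ k}\<bar> \<le> e * C" if "e \<le> d" for e
    using that
  proof (induction e)
    \<comment> \<open>A nonzero digit \<open>d\<close> forces \<open>b ^ k \<le> r\<close>, so
      \<open>block\<close> applies.\<close>
    case (Suc e)
    then have "b ^ k \<le> r" using assms(1) unfolding d_def
      by (metis Suc_le_lessD div_less less_nat_zero_code not_le order_less_le_trans)
    then have "\<bar>sum f {(A + e) * b ^ k..<Suc (A + e) * b ^ k}\<bar> \<le> C"
      using Suc.prems \<open>r \<le> R\<close> by (intro block) simp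
    moreover have "sum f {A * b ^ k..<(A + e) * b ^ k} + sum f {(A + e) * b ^ k..<Suc (A + e) * b ^ k} =
        sum f {A * b ^ k..<(A + Suc e) * b ^ k}"
      by (subst sum.atLeastLessThan_concat) auto
    ultimately show ?case using Suc by (simp add: distrib_right)
  qed simp
  from this[of d] have "\<bar>sum f {A * b ^ k..<(A + d) * b ^ k}\<bar> \<le> d * C" by simp
  also have "\<dots> \<le> b * C" using d assms(2) by (intro mult_right_mono) auto
  finally have 1: "\<bar>sum f {A * b ^ k..<(A + d) * b ^ k}\<bar> \<le> b * C" .
  have 2: "\<bar>sum f {(A + d) * b ^ k..<(A + d) * b ^ k + r mod b ^ k}\<bar> \<le> k * b * C"
    using assms(1) Suc.prems by (intro Suc.IH) (auto intro: order_trans[OF mod_less_eq_dividend])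
  have "a * b ^ Suc k + r = (A + d) * b ^ k + r mod b ^ k"
    by (subst r) (simp add: A_def algebra_simps)
  then have "sum f {a * b ^ Suc k..<a * b ^ Suc k + r} =
      sum f {A * b ^ k..<(A + d) * b ^ k} + sum f {(A + d) * b ^ k..<(A + d) * b ^ k + r mod b ^ k}"
    by (subst sum.atLeastLessThan_concat) (auto simp: A_def mult.assoc)
  with 1 2 show ?case by (simp add: distrib_right)
qed simp

text \<open>The digit cutting is applied twice, first to \<open>n\<close> with \<open>m\<close> in a
  fixed block, then to \<open>m\<close>. Each pair of blocks is a pair of coprime lattices, and one
  \<open>T\<close> serves all block lengths up to \<open>R\<close>.\<close>

lemma cross_pair_discrepancy:
  fixes M M' R k :: nat and t T :: real
  assumes v: "separated_corput b v" "2 \<le> b" and w: "separated_corput c w" "2 \<le> c"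
    and cop: "coprime b c" and t: "0 \<le> t" "t < 1/2" "t * R \<le> T"
    and M: "M \<le> R" "M' \<le> R" "R < 2 ^ k"
  shows "\<bar>\<Sum>m<M. \<Sum>n<M'. (of_bool (\<bar>v m - w n\<bar> \<le> t) - 2 * t)\<bar> \<le>
           k * b * (k * c * (1 + 2 * (T + 1)\<^sup>2))"
proof -
  let ?D = "\<lambda>m n. of_bool (\<bar>v m - w n\<bar> \<le> t) - 2 * t :: real"
  define C where "C = 1 + 2 * (T + 1)\<^sup>2"
  have C: "0 \<le> C" by (simp add: C_def)
  \<comment> \<open>Both bases are at least 2, so \<open>k\<close> digits suffice in either.\<close>
  have pow: "R < b ^ k" "R < c ^ k"
    using M(3) power_mono[of 2 b k] power_mono[of 2 c k] v w by linarith+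
  have bounds: "0 \<le> v n" "v n < 1" "0 \<le> w n" "w n < 1" for n
    using v w by (auto simp: separated_corput_def)
  have block: "\<bar>\<Sum>n\<in>{a' * c ^ i'..<Suc a' * c ^ i'}. \<Sum>m\<in>{a * b ^ i..<Suc a * b ^ i}. ?D m n\<bar> \<le> C"
    if le: "b ^ i \<le> R" "c ^ i' \<le> R" for a i a' i'
  proof -
    have vsum: "(\<Sum>m\<in>{a * b ^ i..<Suc a * b ^ i}. g (v m)) = (\<Sum>j<b ^ i. g ((real j + v a) / b ^ i))"
      for g :: "real \<Rightarrow> real" using v unfolding separated_corput_def by blast
    have wsum: "(\<Sum>n\<in>{a' * c ^ i'..<Suc a' * c ^ i'}. g (w n)) = (\<Sum>j<c ^ i'. g ((real j + w a') / c ^ i'))"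
      for g :: "real \<Rightarrow> real" using w unfolding separated_corput_def by blast
    have "(\<Sum>n\<in>{a' * c ^ i'..<Suc a' * c ^ i'}. \<Sum>m\<in>{a * b ^ i..<Suc a * b ^ i}. ?D m n) =
      (\<Sum>n\<in>{a' * c ^ i'..<Suc a' * c ^ i'}. \<Sum>j<b ^ i. of_bool (\<bar>(real j + v a) / b ^ i - w n\<bar> \<le> t) - 2 * t)"
      by (intro sum.cong refl vsum[of "\<lambda>x. of_bool (\<bar>x - _\<bar> \<le> t) - 2 * t"])
    also have "\<dots> = (\<Sum>l<c ^ i'. \<Sum>j<b ^ i.
        of_bool (\<bar>(real j + v a) / b ^ i - (real l + w a') / c ^ i'\<bar> \<le> t) - 2 * t)"
      by (rule wsum[of "\<lambda>y. \<Sum>j<b ^ i. of_bool (\<bar>(real j + v a) / b ^ i - y\<bar> \<le> t) - 2 * t"])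
    also have "\<dots> = (\<Sum>j<b ^ i. \<Sum>l<c ^ i'.
        of_bool (\<bar>(real j + v a) / b ^ i - (real l + w a') / c ^ i'\<bar> \<le> t) - 2 * t)"
      by (rule sum.swap)
    finally have eq: "(\<Sum>n\<in>{a' * c ^ i'..<Suc a' * c ^ i'}. \<Sum>m\<in>{a * b ^ i..<Suc a * b ^ i}. ?D m n) = \<dots>" .
    have "t * real (b ^ i) \<le> T" "t * real (c ^ i') \<le> T"
      using le t by (meson mult_left_mono of_nat_le_iff order_trans)+
    then show ?thesis
      unfolding eq C_def using v w cop t bounds
      by (intro lattice_pair_discrepancy) auto
  qed
  have "\<bar>\<Sum>m\<in>{a * b ^ i..<Suc a * b ^ i}. \<Sum>n<M'. ?D m n\<bar> \<le> k * c * C" if "b ^ i \<le> R" for a i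
  proof -
    have "\<bar>\<Sum>n\<in>{0 * c ^ k..<0 * c ^ k + M'}. \<Sum>m\<in>{a * b ^ i..<Suc a * b ^ i}. ?D m n\<bar> \<le> k * c * C"
      using w C that M pow by (intro sum_prefix_bound[where R = R and C = C] block) auto
    then show ?thesis by (subst sum.swap) (simp add: lessThan_atLeast0)
  qed
  \<comment> \<open>The bound for the inner cutting becomes the block constant of the outer
    one.\<close>
  then have "\<bar>\<Sum>m\<in>{0 * b ^ k..<0 * b ^ k + M}. \<Sum>n<M'. ?D m n\<bar> \<le> k * b * (k * c * C)"
    using v C M pow by (intro sum_prefix_bound[where R = R and C = "k * c * C"]) auto
  then show ?thesis by (simp add: lessThan_atLeast0 C_def)
qed

section \<open>The interleaved sequence\<close>

text \<open>Nonzero integers are at distance at least \<open>1 - \<theta>\<close> from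
  \<open>z\<close>, which exceeds \<open>t\<close>. So points confined to an interval of length
  \<open>\<theta>\<close> show no wraparound.\<close>

lemma dist_nearest_int_le_iff:
  assumes "\<bar>z\<bar> \<le> \<theta>" "t < 1 - \<theta>"
  shows "dist_nearest_int z \<le> t \<longleftrightarrow> \<bar>z\<bar> \<le> t"
proof
  assume le: "dist_nearest_int z \<le> t"
  have "round z = 0"
  proof (rule ccontr)
    assume "round z \<noteq> 0"
    then have "1 \<le> \<bar>real_of_int (round z)\<bar>" by linarith
    then show False using le assms unfolding dist_nearest_int_def by linarith
  qed
  with le show "\<bar>z\<bar> \<le> t" by (simp add: dist_nearest_int_def)
next
  assume "\<bar>z\<bar> \<le> t"
  then show "dist_nearest_int z \<le> t"
    using round_diff_minimal[of z 0] unfolding dist_nearest_int_def by simp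
qed

locale interleaving =
  fixes K :: nat and b :: "nat \<Rightarrow> nat" and v :: "nat \<Rightarrow> nat \<Rightarrow> real"
  assumes K: "2 \<le> K" and b: "\<And>j. prime (b j)" "inj b"
    and v: "\<And>j. separated_corput (b j) (v j)"
begin

text \<open>For \<open>j < K\<close> this is \<open>(N - j) / K\<close> rounded up: how many of the
  first \<open>N\<close> terms come from \<open>v j\<close>.\<close>

definition num :: "nat \<Rightarrow> nat \<Rightarrow> nat" where
  "num j N = (N + K - 1 - j) div K"

definition cross :: "nat \<Rightarrow> nat \<Rightarrow> real \<Rightarrow> nat \<Rightarrow> real" where
  "cross i j \<tau> N = (\<Sum>m<num i N. \<Sum>n<num j N. of_bool (\<bar>v i m - v j n\<bar> \<le> \<tau> / N))"

definition self :: "nat \<Rightarrow> real \<Rightarrow> nat \<Rightarrow> real" where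
  "self j \<tau> N = (\<Sum>m<num j N. \<Sum>n<num j N. of_bool (m \<noteq> n \<and> \<bar>v j m - v j n\<bar> \<le> \<tau> / N))"

text \<open>The limiting share of ordered pairs that come from different sequences, used as the
  contraction factor.\<close>

definition \<theta> :: real where
  "\<theta> = 1 - 1 / K"

text \<open>Terms are numbered from 1 but each \<open>v j\<close> starts at 0, hence
  \<open>n - 1\<close>.\<close>

definition x :: "nat \<Rightarrow> real" where
  "x n = \<theta> * v ((n - 1) mod K) ((n - 1) div K)"

section \<open>Bounds and index counts\<close>

lemma b_ge_2: "2 \<le> b j"
  using b(1) by (rule prime_ge_2_nat)

lemma \<theta>: "1 / 2 \<le> \<theta>" "0 < \<theta>" "\<theta> < 1"
  using K by (auto simp: \<theta>_def field_simps)

lemma v_bounds: "0 \<le> v j n" "v j n < 1"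
  using v by (auto simp: separated_corput_def)

lemma x_bounds: "0 \<le> x n" "x n < \<theta>"
  using \<theta> v_bounds by (auto simp: x_def)

text \<open>The value \<open>v j q\<close> sits at index \<open>q * K + j + 1\<close>.\<close>

lemma less_num_iff: "j < K \<Longrightarrow> q < num j N \<longleftrightarrow> q * K + j < N"
  using less_eq_div_iff_mult_less_eq[of K "Suc q" "N + K - 1 - j"]
  unfolding num_def by (auto simp: Suc_le_eq[symmetric])

lemma num_le: "j < K \<Longrightarrow> num j N \<le> N"
  using less_num_iff[of j N N] K mult_le_mono2[of 1 K N] by linarith

lemma num_approx:
  assumes "j < K"
  shows "\<bar>real (num j N) - N / K\<bar> \<le> 1"
proof -
  have "num j N * K \<le> N + K - 1 - j" unfolding num_def by (rule div_times_less_eq_dividend)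
  then have 1: "num j N * K \<le> N + K" by simp
  have "\<not> num j N * K + j < N" using less_num_iff[OF assms] by blast
  then have 2: "N \<le> num j N * K + K" using assms by simp
  have "real (num j N) * K \<le> N + K" "real N \<le> real (num j N) * K + K"
    using 1 2 by (metis of_nat_add of_nat_le_iff of_nat_mult)+
  then show ?thesis using K by (simp add: abs_le_iff field_simps)
qed

lemma num_density:
  assumes "j < K"
  shows "(\<lambda>N. num j N / real N) \<longlonglongrightarrow> 1 / K"
proof (rule Lim_null[THEN iffD2], rule Lim_null_comparison)
  show "\<forall>\<^sub>F N in sequentially. norm (num j N / real N - 1 / K) \<le> 1 / N"
    using eventually_gt_at_top[of 0]
  proof eventually_elim
    case (elim N)
    have "num j N / real N - 1 / K = (real (num j N) - N / K) / N" using elim by (simp add: field_simps)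
    then show ?case using num_approx[OF assms, of N] elim by (simp add: divide_right_mono)
  qed
qed real_asymp

lemma sum_by_residues:
  fixes h :: "nat \<Rightarrow> real"
  shows "(\<Sum>n\<in>{1..N}. h n) = (\<Sum>j<K. \<Sum>q<num j N. h (q * K + j + 1))"
proof -
  have "(\<Sum>j<K. \<Sum>q<num j N. h (q * K + j + 1)) =
        (\<Sum>(j, q)\<in>Sigma {..<K} (\<lambda>j. {..<num j N}). h (q * K + j + 1))"
    by (rule sum.Sigma) auto
  also have "\<dots> = (\<Sum>n\<in>{1..N}. h n)"
    using K by (intro sum.reindex_bij_witness[of _ "\<lambda>n. ((n - 1) mod K, (n - 1) div K)"
      "\<lambda>(j, q). q * K + j + 1"]) (auto simp: less_num_iff)
  finally show ?thesis by simp
qed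

section \<open>Pairs from different sequences\<close>

text \<open>With \<open>t = \<tau> / N\<close> and \<open>R = N\<close> the product
  \<open>t * R\<close> is the constant \<open>\<tau>\<close>, so the discrepancy is of order
  \<open>(log 2 N)\<^sup>2\<close> and vanishes after division by \<open>N\<close>.\<close>

lemma cross_limit:
  assumes ij: "i < K" "j < K" "i \<noteq> j" and \<tau>: "0 < \<tau>"
  shows "(\<lambda>N. cross i j \<tau> N / N) \<longlonglongrightarrow> 2 * \<tau> * (1 / K * (1 / K))"
proof -
  define C where "C = real (b i) * b j * (1 + 2 * (\<tau> + 1)\<^sup>2)"
  have C: "0 \<le> C" by (simp add: C_def)
  have cop: "coprime (b i) (b j)"
    using b ij by (intro primes_coprime) (auto dest: injD)
  have "(\<lambda>N. cross i j \<tau> N / N - 2 * \<tau> * (num i N / real N * (num j N / real N))) \<longlonglongrightarrow> 0"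
  proof (rule Lim_null_comparison)
    show "\<forall>\<^sub>F N in sequentially. norm (cross i j \<tau> N / N - 2 * \<tau> * (num i N / real N * (num j N / real N)))
            \<le> C * ((log 2 N + 1)\<^sup>2 / N)"
      \<comment> \<open>Such \<open>N\<close> satisfy \<open>\<tau> / N < 1/2\<close>.\<close>
      using eventually_gt_at_top[of "nat \<lceil>2 * \<tau>\<rceil> + 1"]
    proof eventually_elim
      case (elim N)
      then have N: "2 * \<tau> < N" "1 < N" by linarith+
      \<comment> \<open>The number of binary digits of \<open>N\<close>.\<close>
      define k where "k = nat \<lfloor>log 2 N\<rfloor> + 1"
      have "0 \<le> log 2 N" using N by simp
      then have k: "k \<le> log 2 N + 1" "log 2 N < k" unfolding k_def by linarith+
      have "real N < 2 powr k" using k(2) N by (simp add: log_less_iff)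
      then have "real N < real (2 ^ k)" by (simp add: powr_realpow)
      then have Nk: "N < 2 ^ k" by (simp only: of_nat_less_iff)
      have "\<bar>\<Sum>m<num i N. \<Sum>n<num j N. (of_bool (\<bar>v i m - v j n\<bar> \<le> \<tau> / N) - 2 * (\<tau> / N))\<bar>
          \<le> k * b i * (k * b j * (1 + 2 * (\<tau> + 1)\<^sup>2))"
        using v b_ge_2 cop ij N \<tau> num_le Nk
        by (intro cross_pair_discrepancy[where R = N]) (auto simp: field_simps)
      also have "\<dots> = C * (real k)\<^sup>2" by (simp add: C_def power2_eq_square mult_ac)
      also have "\<dots> \<le> C * (log 2 N + 1)\<^sup>2" using C k by (intro mult_left_mono power_mono) auto
      also have "(\<Sum>m<num i N. \<Sum>n<num j N. (of_bool (\<bar>v i m - v j n\<bar> \<le> \<tau> / N) - 2 * (\<tau> / N))) =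
          cross i j \<tau> N - num i N * (num j N * (2 * (\<tau> / N)))"
        by (simp add: cross_def sum_subtractf)
      also have "\<dots> = N * (cross i j \<tau> N / N - 2 * \<tau> * (num i N / real N * (num j N / real N)))"
        using N by (simp add: field_simps)
      finally have "\<bar>cross i j \<tau> N / N - 2 * \<tau> * (num i N / real N * (num j N / real N))\<bar> * N
          \<le> C * (log 2 N + 1)\<^sup>2"
        by (simp only: abs_mult abs_of_nat mult.commute[of "real N"])
      then show ?case using N by (simp add: pos_le_divide_eq)
    qed
    have "(\<lambda>N :: nat. (log 2 N + 1)\<^sup>2 / N) \<longlonglongrightarrow> 0" by real_asymp
    then show "(\<lambda>N :: nat. C * ((log 2 N + 1)\<^sup>2 / N)) \<longlonglongrightarrow> 0"
      by (rule tendsto_mult_right_zero)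
  qed
  moreover have "(\<lambda>N. 2 * \<tau> * (num i N / real N * (num j N / real N))) \<longlonglongrightarrow> 2 * \<tau> * (1 / K * (1 / K))"
    by (intro tendsto_intros num_density ij)
  ultimately show ?thesis using tendsto_add by fastforce
qed

text \<open>Undoing the contraction turns \<open>s\<close> into \<open>s / \<theta>\<close>.\<close>

definition cross_corr :: "real \<Rightarrow> nat \<Rightarrow> real" where
  "cross_corr s N = (\<Sum>i<K. \<Sum>j<K. if i = j then 0 else cross i j (s / \<theta>) N / N)"

text \<open>Each of the \<open>K * (K - 1)\<close> ordered pairs of sequences contributes
  \<open>2 * (s / \<theta>) / K\<^sup>2\<close>, in total
  \<open>2 * (s / \<theta>) * \<theta>\<close>.\<close>

lemma cross_corr_limit:
  assumes "0 < s"
  shows "cross_corr s \<longlonglongrightarrow> 2 * s"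
proof -
  have "(\<lambda>N. cross_corr s N) \<longlonglongrightarrow> (\<Sum>i<K. \<Sum>j<K. if i = j then 0 else 2 * (s / \<theta>) * (1 / K * (1 / K)))"
    unfolding cross_corr_def
  proof (intro tendsto_sum)
    fix i j assume "i \<in> {..<K}" "j \<in> {..<K}"
    then show "(\<lambda>N. if i = j then 0 else cross i j (s / \<theta>) N / real N)
        \<longlonglongrightarrow> (if i = j then 0 else 2 * (s / \<theta>) * (1 / K * (1 / K)))"
      using cross_limit[of i j "s / \<theta>"] assms \<theta> by auto
  qed
  also have "(\<Sum>i<K. \<Sum>j<K. if i = j then 0 else 2 * (s / \<theta>) * (1 / K * (1 / K))) =
      (\<Sum>i<K. real (K - 1) * (2 * (s / \<theta>) * (1 / K * (1 / K))))"
  proof (rule sum.cong)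
    fix i assume "i \<in> {..<K}"
    then show "(\<Sum>j<K. if i = j then 0 else 2 * (s / \<theta>) * (1 / K * (1 / K))) =
        real (K - 1) * (2 * (s / \<theta>) * (1 / K * (1 / K)))"
      by (subst sum.remove[of _ i]) (auto simp: sum.If_cases card_Diff_singleton Int_absorb1)
  qed simp
  also have "\<dots> = 2 * (s / \<theta>) * \<theta>"
    using K unfolding \<theta>_def[THEN eq_reflection] by (simp add: field_simps of_nat_diff)
  also have "\<dots> = 2 * s" using \<theta> by simp
  finally show ?thesis .
qed

section \<open>Splitting the pair correlation\<close>

text \<open>Once \<open>s / N\<close> is below the gap length \<open>1 - \<theta>\<close>, the
  distance to the nearest integer may be replaced by the absolute value; the pairs are then sorted
  by the sequences they come from.\<close>

lemma pair_corr_eq: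
  assumes N: "0 < N" "s / N < 1 - \<theta>"
  shows "pair_corr x s N = cross_corr s N + (\<Sum>i<K. self i (s / \<theta>) N) / N"
proof -
  let ?h = "\<lambda>m n. of_bool (m \<noteq> n \<and> dist_nearest_int (x m - x n) \<le> s / N) :: real"
  have near: "dist_nearest_int (x m - x n) \<le> s / N \<longleftrightarrow> \<bar>x m - x n\<bar> \<le> s / N" for m n
    using x_bounds[of m] x_bounds[of n] N by (intro dist_nearest_int_le_iff[of _ \<theta>]) (auto simp: abs_le_iff)
  have x_val: "x (q * K + i + 1) = \<theta> * v i q" if "i < K" for i q
    using that by (simp add: x_def)
  have scale: "\<bar>\<theta> * y - \<theta> * z\<bar> \<le> s / N \<longleftrightarrow> \<bar>y - z\<bar> \<le> s / \<theta> / N" for y z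
  proof -
    have "\<bar>\<theta> * y - \<theta> * z\<bar> = \<theta> * \<bar>y - z\<bar>"
      using \<theta> by (simp add: abs_mult flip: right_diff_distrib)
    then show ?thesis using \<theta> N by (simp add: field_simps)
  qed
  \<comment> \<open>Uniqueness of quotient and remainder: indices from different sequences never
    coincide, so \<open>m \<noteq> n\<close> restricts only the \<open>self\<close> terms.\<close>
  have index: "q * K + i = q' * K + j \<longleftrightarrow> i = j \<and> q = q'" if "i < K" "j < K" for q q' i j
    using that
    by (metis add.commute add_left_cancel div_mult_self3 div_less less_nat_zero_code mod_less
        mod_mult_self1 mult_cancel2)
  have "real (card {(m, n). m \<in> {1..N} \<and> n \<in> {1..N} \<and> m \<noteq> n \<and> dist_nearest_int (x m - x n) \<le> s / N}) =
      (\<Sum>(m, n)\<in>{1..N} \<times> {1..N}. ?h m n)"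
    by (simp add: case_prod_unfold of_bool_def sum.If_cases)
       (rule arg_cong[where f = card], auto)
  also have "\<dots> = (\<Sum>m\<in>{1..N}. \<Sum>n\<in>{1..N}. ?h m n)"
    by (rule sum.cartesian_product[symmetric])
  also have "\<dots> = (\<Sum>i<K. \<Sum>m<num i N. \<Sum>j<K. \<Sum>n<num j N. ?h (m * K + i + 1) (n * K + j + 1))"
    by (simp only: sum_by_residues)
  also have "\<dots> = (\<Sum>i<K. \<Sum>j<K. \<Sum>m<num i N. \<Sum>n<num j N. ?h (m * K + i + 1) (n * K + j + 1))"
    by (intro sum.cong refl sum.swap)
  also have "\<dots> = (\<Sum>i<K. \<Sum>j<K. if i = j then self i (s / \<theta>) N else cross i j (s / \<theta>) N)"
  proof (intro sum.cong refl)
    fix i j assume "i \<in> {..<K}" "j \<in> {..<K}"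
    then have ij: "i < K" "j < K" by auto
    have "?h (m * K + i + 1) (n * K + j + 1) =
        of_bool (\<not> (i = j \<and> m = n) \<and> \<bar>v i m - v j n\<bar> \<le> s / \<theta> / N)" for m n
      unfolding near by (simp only: x_val[OF ij(1)] x_val[OF ij(2)] scale add_right_cancel index[OF ij])
    then show "(\<Sum>m<num i N. \<Sum>n<num j N. ?h (m * K + i + 1) (n * K + j + 1)) =
        (if i = j then self i (s / \<theta>) N else cross i j (s / \<theta>) N)"
      by (auto simp: self_def cross_def)
  qed
  also have "\<dots> = (\<Sum>i<K. \<Sum>j<K. (if i = j then 0 else cross i j (s / \<theta>) N) +
      (if i = j then self i (s / \<theta>) N else 0))"
    by (intro sum.cong) auto
  also have "\<dots> = N * cross_corr s N + (\<Sum>i<K. self i (s / \<theta>) N)"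
  proof -
    have "N * cross_corr s N = (\<Sum>i<K. \<Sum>j<K. if i = j then 0 else cross i j (s / \<theta>) N)"
      unfolding cross_corr_def sum_distrib_left using N by (intro sum.cong) auto
    moreover have "(\<Sum>i<K. \<Sum>j<K. if i = j then self i (s / \<theta>) N else 0) = (\<Sum>i<K. self i (s / \<theta>) N)"
      by simp
    ultimately show ?thesis by (simp only: sum.distrib)
  qed
  finally show ?thesis using N unfolding pair_corr_def by (simp add: add_divide_distrib)
qed

lemma eventually_pair_corr_eq:
  "\<forall>\<^sub>F N in sequentially. pair_corr x s N = cross_corr s N + (\<Sum>i<K. self i (s / \<theta>) N) / N"
proof -
  have "(\<lambda>N :: nat. s / N) \<longlonglongrightarrow> 0" by real_asymp
  then have "\<forall>\<^sub>F N in sequentially. s / real N < 1 - \<theta>"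
    using \<theta> by (intro order_tendstoD(2)) auto
  with eventually_gt_at_top[of 0] show ?thesis
    by eventually_elim (rule pair_corr_eq)
qed

section \<open>Pairs from the same sequence\<close>

text \<open>A position \<open>n\<close> below \<open>num j N\<close> has \<open>n * K < N\<close>,
  so the separation \<open>1 / (3 * n)\<close> exceeds \<open>K / (3 * N)\<close>, which is at least
  \<open>\<tau> / N\<close>.\<close>

lemma self_eq_0:
  fixes \<tau> :: real
  assumes "j < K" "0 < \<tau>" "3 * \<tau> \<le> K"
  shows "self j \<tau> N = 0"
proof -
  have far: "\<tau> / N < \<bar>v j m - v j n\<bar>" if "m < n" "n < num j N" for m n
  proof -
    have "n * K < N" using less_num_iff[OF assms(1)] that(2) by auto
    then have "real n * K < N" by (metis of_nat_less_iff of_nat_mult)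
    moreover have "real n * (3 * \<tau>) \<le> real n * K" using assms by (intro mult_left_mono) auto
    ultimately have "\<tau> * (3 * real n) < 1 * N" by (simp add: mult_ac)
    moreover have "0 < real N" "0 < 3 * real n" using \<open>n * K < N\<close> that by auto
    ultimately have "\<tau> / N < 1 / (3 * real n)" by (simp add: pos_divide_less_eq pos_less_divide_eq)
    also have "\<dots> \<le> \<bar>v j m - v j n\<bar>" using v that(1) by (auto simp: separated_corput_def)
    finally show ?thesis .
  qed
  have "\<not> (m \<noteq> n \<and> \<bar>v j m - v j n\<bar> \<le> \<tau> / N)" if "m < num j N" "n < num j N" for m n
    using far[of m n] far[of n m] that by (cases m n rule: linorder_cases) (auto simp: abs_minus_commute)
  then show ?thesis unfolding self_def by (intro sum.neutral ballI) auto
qed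

text \<open>The pairs counted here are \<open>(m, m + b\<^sub>0\<^sup>i)\<close> with \<open>m < b\<^sub>0\<^sup>i\<close>.\<close>

lemma self_ge:
  assumes N: "N = 2 * K * b 0 ^ i"
  shows "real (b 0 ^ i) \<le> self 0 (2 * K) N"
proof -
  define B where "B = b 0 ^ i"
  have B: "0 < B" using b_ge_2[of 0] by (simp add: B_def)
  \<comment> \<open>This \<open>N\<close> gives sequence 0 exactly \<open>2 * B\<close> terms and
    makes the tolerance \<open>1 / B\<close>.\<close>
  have num: "num 0 N = 2 * B"
    using K B unfolding num_def N B_def[symmetric] by (auto intro!: div_nat_eqI simp: algebra_simps)
  have t: "real (2 * K) / N = 1 / B" using K B unfolding N B_def[symmetric] by simp
  have near: "\<bar>v 0 m - v 0 (B + m)\<bar> \<le> 1 / B" if "m < B" for m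
  proof -
    \<comment> \<open>Prepending the digit 1 to \<open>m\<close> moves the value by
      \<open>v 0 1 / B\<close> only.\<close>
    have "v 0 (1 * b 0 ^ i + m) = v 0 m + v 0 1 / b 0 ^ i"
      using v[of 0] that unfolding separated_corput_def B_def by blast
    then have "\<bar>v 0 m - v 0 (B + m)\<bar> = v 0 1 / B" using v_bounds by (simp add: B_def)
    also have "\<dots> \<le> 1 / B" using v_bounds[of 0 1] by (intro divide_right_mono) auto
    finally show ?thesis .
  qed
  let ?h = "\<lambda>m n. of_bool (m \<noteq> n \<and> \<bar>v 0 m - v 0 n\<bar> \<le> 1 / B) :: real"
  have "real B = (\<Sum>m<B. ?h m (B + m))" using near B by simp
  also have "\<dots> \<le> (\<Sum>m<B. \<Sum>n<2 * B. ?h m n)"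
    by (intro sum_mono member_le_sum) auto
  also have "\<dots> \<le> (\<Sum>m<2 * B. \<Sum>n<2 * B. ?h m n)"
    by (intro sum_mono2) (auto intro: sum_nonneg)
  also have "\<dots> = self 0 (2 * K) N" unfolding self_def num t ..
  finally show ?thesis by (simp add: B_def)
qed

section \<open>Properties of the interleaved sequence\<close>

lemma pair_corr_limit:
  fixes s :: real
  assumes "0 < s" "6 * s \<le> K"
  shows "pair_corr x s \<longlonglongrightarrow> 2 * s"
proof -
  \<comment> \<open>As \<open>\<theta> \<ge> 1 / 2\<close>, the factor 6 in the hypothesis yields
    the 3 required for the \<open>self\<close> terms to vanish.\<close>
  have "s / \<theta> \<le> s / (1 / 2)" using \<theta> assms by (intro divide_left_mono) auto
  then have "3 * (s / \<theta>) \<le> K" using assms by simp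
  then have "\<forall>\<^sub>F N in sequentially. pair_corr x s N = cross_corr s N"
    using eventually_pair_corr_eq[of s] assms \<theta> by (simp add: self_eq_0)
  then show ?thesis using cross_corr_limit[OF assms(1)] by (simp add: filterlim_cong)
qed

text \<open>The interval from \<open>\<theta>\<close> to 1 has positive length and contains no
  term.\<close>

lemma not_uniformly_distributed: "\<not> uniformly_distributed_mod1 x"
proof
  assume "uniformly_distributed_mod1 x"
  then have "(\<lambda>N. real (card {i \<in> {1..N}. x i \<in> {\<theta>..1}}) / real N) \<longlonglongrightarrow> 1 - \<theta>"
    using \<theta> unfolding uniformly_distributed_mod1_def by auto
  moreover have "{i \<in> {1..N}. x i \<in> {\<theta>..1}} = {}" for N
    using x_bounds(2) by (auto simp: not_le[symmetric])
  ultimately have "(\<lambda>N :: nat. real (card ({} :: nat set)) / real N) \<longlonglongrightarrow> 1 - \<theta>" by (simp only:)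
  then show False using \<theta> by (simp add: tendsto_const_iff)
qed

text \<open>Shown directly, not through the failure of uniform distribution: the cross pairs alone
  already tend to \<open>2 * s\<close>, and along the indices \<open>N i\<close> the
  \<open>self\<close> terms add at least \<open>1 / (2 * K)\<close>.\<close>

lemma not_poissonian: "\<not> poissonian_pair_correlations x"
proof
  \<comment> \<open>Chosen so that \<open>s / \<theta>\<close> is the \<open>2 * K\<close> of
    \<open>self_ge\<close>.\<close>
  define s where "s = 2 * K * \<theta>"
  have s: "0 < s" "s / \<theta> = 2 * K" using K \<theta> by (auto simp: s_def)
  define N where "N i = 2 * K * b 0 ^ i" for i
  have "strict_mono N"
    using K b_ge_2[of 0] by (auto simp: strict_mono_def N_def intro!: power_strict_increasing)
  then have N: "filterlim N sequentially sequentially" by (rule filterlim_subseq)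
  assume "poissonian_pair_correlations x"
  then have "pair_corr x s \<longlonglongrightarrow> 2 * s" using s unfolding poissonian_pair_correlations_def by blast
  from tendsto_diff[OF this cross_corr_limit[OF s(1)]]
  have "(\<lambda>n. pair_corr x s n - cross_corr s n) \<longlonglongrightarrow> 0" by simp
  then have "(\<lambda>i. pair_corr x s (N i) - cross_corr s (N i)) \<longlonglongrightarrow> 0"
    by (rule filterlim_compose[OF _ N])
  moreover have "\<forall>\<^sub>F i in sequentially. 1 / (2 * K) \<le> pair_corr x s (N i) - cross_corr s (N i)"
    using filterlim_iff[THEN iffD1, OF N, rule_format, OF eventually_pair_corr_eq[of s]]
  proof eventually_elim
    case (elim i)
    have "real (b 0 ^ i) \<le> self 0 (s / \<theta>) (N i)" using self_ge[of "N i" i] by (simp add: N_def s)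
    also have "\<dots> \<le> (\<Sum>j<K. self j (s / \<theta>) (N i))"
      using K by (intro member_le_sum) (auto simp: self_def intro!: sum_nonneg)
    finally have "real (b 0 ^ i) / N i \<le> (\<Sum>j<K. self j (s / \<theta>) (N i)) / N i"
      by (rule divide_right_mono) simp
    moreover have "real (b 0 ^ i) / N i = 1 / (2 * K)" using b_ge_2[of 0] by (simp add: N_def)
    ultimately show ?case using elim by simp
  qed
  ultimately have "1 / real (2 * K) \<le> 0" by (rule tendsto_lowerbound) simp
  then show False using K by simp
qed

end

theorem theorem3:
  fixes S :: real
  assumes "S > 0"
  shows "\<exists>x :: nat \<Rightarrow> real.
           (\<forall>n\<ge>1. x n \<in> {0..1}) \<and>
           (\<forall>s. 0 < s \<and> s < S \<longrightarrow> (\<lambda>N. pair_corr x s N) \<longlonglongrightarrow> 2 * s) \<and>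
           \<not> uniformly_distributed_mod1 x \<and>
           \<not> poissonian_pair_correlations x"
proof -
  \<comment> \<open>The ceiling gives \<open>6 * s \<le> K\<close> for all \<open>s < S\<close>; the
    summand 2 guarantees \<open>2 \<le> K\<close>.\<close>
  define K where "K = nat \<lceil>6 * S\<rceil> + 2"
  have K: "2 \<le> K" and S: "6 * S \<le> K" unfolding K_def by linarith+
  define b where "b = enumerate {p :: nat. prime p}"
  have b: "prime (b j)" for j
    using enumerate_in_set[OF primes_infinite] by (simp add: b_def)
  have "inj b"
    unfolding b_def by (intro strict_mono_imp_inj_on strict_mono_enumerate primes_infinite)
  moreover obtain v where "separated_corput (b j) (v j)" for j
    using exists_separated_corput[OF prime_ge_2_nat[OF b]] by metis
  ultimately interpret interleaving K b v using K b by unfold_locales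
  have "x n \<in> {0..1}" for n using x_bounds[of n] \<theta> by simp
  then show ?thesis
    using pair_corr_limit S not_uniformly_distributed not_poissonian
    by (intro exI[of _ x]) auto
qed

end
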